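(* Let $n$ be a nonnegative integer. There is a delicate squarefree ternary word of length $n$ if and only if $n \in \{5\} \cup \{m \mid m \geq 7\}$.
   Context: Words are finite strings over the ternary alphabet $\{0,1,2\}$. A factor of a word is a contiguous subword. A square is a word of the form $XX$ with $X$ a nonempty word; a word is squarefree if none of its factors is a square. A delicate squarefree word is a nonempty squarefree word such that changing any single one of its letters to a different letter of the alphabet yields a word containing a square as a factor. *)

theory Defs
  imports Main "HOL-Library.Sublist"
begin

text \<open>
  Words are lists; a factor (contiguous subword) is a \<^const>\<open>sublist\<close>. The letters are the
  natural numbers 0, 1, 2. The notion of a squarefree word below is unrelated to squarefree
  elements of a ring.
\<close>

definition alphabet :: "nat set" where
  "alphabet = {0, 1, 2}"

definition square :: "'a list \<Rightarrow> bool" where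
  "square w \<longleftrightarrow> (\<exists>X. X \<noteq> [] \<and> w = X @ X)"

definition squarefree_word :: "'a list \<Rightarrow> bool" where
  "squarefree_word w \<longleftrightarrow> (\<forall>u. sublist u w \<longrightarrow> \<not> square u)"

definition delicate :: "nat list \<Rightarrow> bool" where
  "delicate w \<longleftrightarrow> w \<in> lists alphabet \<and> w \<noteq> [] \<and> squarefree_word w \<and>
     (\<forall>i < length w. \<forall>a \<in> alphabet. a \<noteq> w ! i \<longrightarrow>
        (\<exists>u. sublist u (w[i := a]) \<and> square u))"

end

theory Submission
  imports Defs
begin

text \<open>
  In a squarefree ternary word an interior letter is almost automatically delicate: if its
  neighbours differ, any change repeats one of them, and if it is the centre of \<open>bcb\<close>, the word
  continues as \<open>bcba\<close>, so that changing \<open>c\<close> to \<open>a\<close> yields \<open>baba\<close>. Only the two end letters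
  impose a condition, which holds for words that start like \<open>abcb\<close> and end like \<open>bcba\<close>. It
  therefore suffices to find, for each distance \<open>d = 0\<close> or \<open>d \<ge> 2\<close>, two palindromes \<open>bcb\<close> with
  centres \<open>d\<close> apart in one infinite squarefree word. The fixed point of Leech's
  \<open>13\<close>-uniform morphism provides all of them: each block has centres at offsets
  \<open>2\<close>, \<open>6\<close> and \<open>10\<close>, and each boundary between two blocks is adjacent to exactly one more centre,
  whose side depends on whether the coding letter goes up or down modulo \<open>3\<close>.
\<close>

section \<open>Squares by positions\<close>

text \<open>A square is recorded by its start and its period, without a length bound, so that one
  notion serves finite words (through \<open>nth\<close>) and the infinite word
  \<open>leech\<close>. For finite words the bound is added separately.\<close>

definition square_at :: "(nat \<Rightarrow> 'a) \<Rightarrow> nat \<Rightarrow> nat \<Rightarrow> bool" where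
  "square_at f k p \<longleftrightarrow> p > 0 \<and> (\<forall>j<p. f (k + j) = f (k + p + j))"

lemma has_square_iff:
  "(\<exists>u. sublist u w \<and> square u) \<longleftrightarrow>
   (\<exists>k p. k + 2 * p \<le> length w \<and> square_at (nth w) k p)"
proof
  assume "\<exists>u. sublist u w \<and> square u"
  then obtain X ps ss where X: "X \<noteq> []" and w: "w = ps @ (X @ X) @ ss"
    unfolding sublist_def square_def by blast
  have "square_at (nth w) (length ps) (length X)"
    unfolding square_at_def using X by (auto simp: w nth_append)
  moreover have "length ps + 2 * length X \<le> length w"
    by (simp add: w)
  ultimately show "\<exists>k p. k + 2 * p \<le> length w \<and> square_at (nth w) k p"
    by blast
next
  assume "\<exists>k p. k + 2 * p \<le> length w \<and> square_at (nth w) k p"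
  then obtain k p where len: "k + 2 * p \<le> length w" and p: "p > 0"
    and eq: "\<And>j. j < p \<Longrightarrow> w ! (k + j) = w ! (k + p + j)"
    unfolding square_at_def by blast
  let ?X = "take p (drop k w)"
  have "?X = take p (drop (k + p) w)"
    by (rule nth_equalityI) (use len eq in auto)
  then have "take (p + p) (drop k w) = ?X @ ?X"
    by (simp add: take_add add.commute)
  moreover have "?X \<noteq> []"
    using len p by auto
  ultimately have "square (take (p + p) (drop k w))"
    unfolding square_def by blast
  moreover have "sublist (take (p + p) (drop k w)) w"
    by (meson sublist_drop sublist_take sublist_order.order_trans)
  ultimately show "\<exists>u. sublist u w \<and> square u"
    by blast
qed

lemma squarefree_word_iff:
  "squarefree_word w \<longleftrightarrow> (\<forall>k p. k + 2 * p \<le> length w \<longrightarrow> \<not> square_at (nth w) k p)"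
  using has_square_iff[of w] unfolding squarefree_word_def by blast

lemma square_at_1: "square_at f k 1 \<longleftrightarrow> f k = f (k + 1)"
  by (simp add: square_at_def)

lemma square_at_2: "square_at f k 2 \<longleftrightarrow> f k = f (k + 2) \<and> f (k + 1) = f (k + 3)"
  by (auto simp: square_at_def numeral_eq_Suc All_less_Suc)

section \<open>Delicacy from conditions at the two ends\<close>

lemma third_letter:
  fixes a b c d :: nat
  assumes "a \<in> alphabet" "b \<in> alphabet" "c \<in> alphabet" "d \<in> alphabet"
    "a \<noteq> b" "c \<noteq> a" "c \<noteq> b" "d \<noteq> a" "d \<noteq> b"
  shows "c = d"
  using assms by (auto simp: alphabet_def)

lemma delicateI:
  assumes w: "w \<in> lists alphabet" and sf: "squarefree_word w" and len: "length w \<ge> 5"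
    and start: "w ! 1 = w ! 3" and finish: "w ! (length w - 4) = w ! (length w - 2)"
  shows "delicate w"
proof -
  define n where "n = length w"
  have n: "n \<ge> 5"
    using len by (simp add: n_def)
  have alph: "w ! i \<in> alphabet" if "i < n" for i
    using that w by (auto simp: n_def in_lists_conv_set)
  have ne1: "w ! k \<noteq> w ! (k + 1)" if "k + 2 \<le> n" for k
    using sf that unfolding squarefree_word_iff n_def by (metis square_at_1 mult_2 one_add_one)
  have ne2: "w ! k = w ! (k + 2) \<Longrightarrow> w ! (k + 1) \<noteq> w ! (k + 3)" if "k + 4 \<le> n" for k
    using sf[unfolded squarefree_word_iff, rule_format, of k 2] that
    by (simp add: square_at_2 n_def)
  have "\<exists>u. sublist u (w[i := a]) \<and> square u"
    if i: "i < n" and a: "a \<in> alphabet" "a \<noteq> w ! i" for i a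
  proof -
    have sq: ?thesis if "k + 2 * p \<le> n" "square_at (nth (w[i := a])) k p" for k p
      using that has_square_iff[of "w[i := a]"] by (auto simp: n_def)
    have nth_upd: "w[i := a] ! k = (if k = i then a else w ! k)" if "k < n" for k
      using that by (auto simp: n_def)
    consider (left) "i \<ge> 1" "w ! (i - 1) = a" | (right) "i + 1 < n" "w ! (i + 1) = a"
      | (none) "i \<ge> 1 \<Longrightarrow> w ! (i - 1) \<noteq> a" "i + 1 < n \<Longrightarrow> w ! (i + 1) \<noteq> a"
      by blast
    then show ?thesis
    proof cases
      case left
      show ?thesis
        by (rule sq[of "i - 1" 1]) (use left i n in \<open>auto simp: square_at_def nth_upd\<close>)
    next
      case right
      show ?thesis
        by (rule sq[of i 1]) (use right i n in \<open>auto simp: square_at_def nth_upd\<close>)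
    next
      case none
      \<comment> \<open>Now no neighbour of position \<open>i\<close> carries \<open>a\<close>, and
        a square of period 2 is needed. A middle position is completed by the second letter on its
        right; position \<open>n - 2\<close> has none and uses the second letter on its
        left.\<close>
      consider (first) "i = 0" | (last) "i = n - 1" | (mid) "i \<ge> 1" "i + 2 < n"
        | (mid_last) "i = n - 2"
        using i by linarith
      then show ?thesis
      proof cases
        case first
        \<comment> \<open>Since \<open>w ! 1 = w ! 3\<close>, squarefreeness forces
          \<open>w ! 0 \<noteq> w ! 2\<close>. So \<open>w ! 2\<close> is the only possible new
          letter, and the changed word starts with a square of period 2.\<close>
        have "a = w ! 2"
          by (rule third_letter[of "w ! 0" "w ! 1"])
            (use first a none n start ne1[of 0] ne1[of 1] ne2[of 0] alph in \<open>auto simp: numeral_eq_Suc\<close>)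
        then have "square_at (nth (w[i := a])) 0 2"
          unfolding square_at_2 using nth_upd[of 0] nth_upd[of 1] nth_upd[of 2] nth_upd[of 3]
          using n start first by (simp add: numeral_eq_Suc)
        then show ?thesis
          using sq[of 0 2] n by simp
      next
        case last
        define k where "k = n - 4"
        have k: "n = k + 4" "i = k + 3"
          using last n by (auto simp: k_def)
        have fin: "w ! k = w ! (k + 2)"
          using finish by (simp add: n_def[symmetric] k)
        have "a = w ! (k + 1)"
          by (rule third_letter[of "w ! (k + 3)" "w ! (k + 2)"])
            (use k a none(1) fin ne1[of k] ne1[of "k + 1"] ne1[of "k + 2"] ne2[of k] alph in
              \<open>auto simp: numeral_eq_Suc\<close>)
        then show ?thesis
          using k fin by (intro sq[of k 2], unfold square_at_2) (auto simp: nth_list_update n_def numeral_eq_Suc)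
      next
        case mid
        define k where "k = i - 1"
        have k: "i = k + 1" "k + 4 \<le> n"
          using mid by (auto simp: k_def)
        \<comment> \<open>Both neighbours avoid the old letter and the new one, so they
          coincide.\<close>
        have eq: "w ! k = w ! (k + 2)"
          by (rule third_letter[of "w ! (k + 1)" a])
            (use k a none ne1[of k] ne1[of "k + 1"] alph in \<open>auto simp: numeral_eq_Suc\<close>)
        \<comment> \<open>The letter after the palindrome cannot be its outer letter, nor its centre
          without creating a square; hence it is \<open>a\<close>.\<close>
        have "a = w ! (k + 3)"
          by (rule third_letter[of "w ! (k + 1)" "w ! (k + 2)"])
            (use k a none eq ne1[of k] ne1[of "k + 1"] ne1[of "k + 2"] ne2[of k] alph in
              \<open>auto simp: numeral_eq_Suc\<close>)
        then show ?thesis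
          using k eq by (intro sq[of k 2], unfold square_at_2) (auto simp: nth_list_update n_def numeral_eq_Suc)
      next
        case mid_last
        define k where "k = n - 4"
        have k: "n = k + 4" "i = k + 2"
          using mid_last n by (auto simp: k_def)
        have eq: "w ! (k + 1) = w ! (k + 3)"
          by (rule third_letter[of "w ! (k + 2)" a])
            (use k a none ne1[of "k + 1"] ne1[of "k + 2"] alph in \<open>auto simp: numeral_eq_Suc\<close>)
        have "a = w ! k"
          by (rule third_letter[of "w ! (k + 1)" "w ! (k + 2)"])
            (use k a none eq ne1[of k] ne1[of "k + 1"] ne1[of "k + 2"] ne2[of k] alph in
              \<open>auto simp: numeral_eq_Suc\<close>)
        then show ?thesis
          using k eq by (intro sq[of k 2], unfold square_at_2) (auto simp: nth_list_update n_def numeral_eq_Suc)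
      qed
    qed
  qed
  then show ?thesis
    using w sf n by (auto simp: delicate_def n_def)
qed

section \<open>Leech's squarefree word\<close>

definition leech_block :: "nat list" where
  "leech_block = [0, 1, 2, 1, 0, 2, 1, 2, 0, 1, 2, 1, 0]"

lemma length_leech_block: "length leech_block = 13"
  by (simp add: leech_block_def)

text \<open>This is the fixed point starting with 0 of the morphism sending \<open>x\<close> to
  \<open>leech_block\<close> shifted by \<open>x\<close> modulo 3. Unfolded, it sums
  \<open>leech_block\<close> over the base 13 digits of \<open>n\<close>. The value at 0 fits the
  recursion, as the block starts with 0.\<close>

fun leech :: "nat \<Rightarrow> nat" where
  "leech n = (if n = 0 then 0 else (leech (n div 13) + leech_block ! (n mod 13)) mod 3)"

declare leech.simps [simp del]

lemma leech_less_3: "leech n < 3"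
  by (subst leech.simps) auto

lemma leech_block_eq: "leech (13 * i + j) = (leech i + leech_block ! j) mod 3" if "j < 13"
proof (cases "13 * i + j = 0")
  case True
  then show ?thesis
    by (simp add: leech.simps leech_block_def)
next
  case False
  then show ?thesis
    using that by (subst leech.simps) auto
qed

lemma leech_mult_13: "leech (13 * i) = leech i"
  using leech_block_eq[of 0 i] leech_less_3[of i] by (simp add: leech_block_def)

section \<open>Up and down steps between consecutive letters\<close>

definition ups :: "nat set" where
  "ups = {0, 1, 6, 7, 8, 9}"

text \<open>Consecutive letters differ, so each step is +1 or +2 modulo 3 and one truth value
  encodes it. Inside a block it depends only on the offset, because shifting the block preserves
  differences.\<close>

definition up :: "nat \<Rightarrow> bool" where
  "up n \<longleftrightarrow> leech (Suc n) = (leech n + 1) mod 3"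

lemma leech_inner_step:
  assumes "j < 12"
  shows "leech (Suc (13 * i + j)) = (leech (13 * i + j) + (if j \<in> ups then 1 else 2)) mod 3"
proof -
  have *: "leech (Suc (13 * i + j)) = (leech i + leech_block ! Suc j) mod 3"
    using leech_block_eq[of "Suc j" i] assms by simp
  have **: "leech (13 * i + j) = (leech i + leech_block ! j) mod 3"
    using leech_block_eq[of j i] assms by simp
  have "list_all (\<lambda>x. list_all (\<lambda>j. (x + leech_block ! Suc j) mod 3 =
      ((x + leech_block ! j) mod 3 + (if j \<in> ups then 1 else 2)) mod 3) [0..<12]) [0..<3]"
    by code_simp
  then show ?thesis
    unfolding * ** using assms leech_less_3[of i] by (simp add: list_all_iff)
qed

text \<open>The block begins and ends with 0, so both letters at a boundary are coding letters. The
  step across it therefore repeats the step of the coding word, which drives the descents by a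
  factor 13.\<close>

lemma leech_boundary:
  "leech (13 * i + 12) = leech i" "leech (Suc (13 * i + 12)) = leech (Suc i)"
proof -
  show "leech (13 * i + 12) = leech i"
    using leech_block_eq[of 12 i] leech_less_3[of i] by (simp add: leech_block_def)
  have "Suc (13 * i + 12) = 13 * Suc i"
    by simp
  then show "leech (Suc (13 * i + 12)) = leech (Suc i)"
    by (metis leech_mult_13)
qed

lemma leech_step_neq: "leech n \<noteq> leech (Suc n)"
proof (induction n rule: less_induct)
  case (less n)
  define i j where "i = n div 13" and "j = n mod 13"
  have n: "n = 13 * i + j" "j < 13"
    by (auto simp: i_def j_def)
  consider "j < 12" | "j = 12"
    using n by linarith
  then show ?case
  proof cases
    case 1
    have "x \<noteq> (x + (if b then 1 else 2)) mod 3" if "x < 3" for x :: nat and b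
      using that by (auto simp: mod_if)
    from this[OF leech_less_3] show ?thesis
      unfolding n(1) leech_inner_step[OF 1] .
  next
    case 2
    then show ?thesis
      using less.IH[of i] leech_boundary[of i] n by auto
  qed
qed

lemma not_up_iff: "\<not> up n \<longleftrightarrow> leech (Suc n) = (leech n + 2) mod 3"
proof -
  have "y = (x + 1) mod 3 \<longleftrightarrow> y \<noteq> (x + 2) mod 3"
    if "x < 3" "y < 3" "x \<noteq> y" for x y :: nat
    using that by (auto simp: mod_if)
  from this[OF leech_less_3 leech_less_3 leech_step_neq] show ?thesis
    by (auto simp: up_def)
qed

lemma up_inner: "j < 12 \<Longrightarrow> up (13 * i + j) \<longleftrightarrow> j \<in> ups"
  using leech_inner_step[of j i] not_up_iff[of "13 * i + j"] by (auto simp: up_def)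

lemma up_boundary: "up (13 * i + 12) \<longleftrightarrow> up i"
  by (simp only: up_def leech_boundary)

text \<open>Found by evaluation: every nontrivial rotation modulo 13 turns some up into a down and
  some down into an up. Offset 12 is avoided on both sides, since the step there varies with the
  block.\<close>

lemma ups_shift:
  assumes "0 < r" "r < 13"
  shows "\<exists>j<12. (j + r) mod 13 < 12 \<and> j \<in> ups \<and> (j + r) mod 13 \<notin> ups"
    and "\<exists>j<12. (j + r) mod 13 < 12 \<and> j \<notin> ups \<and> (j + r) mod 13 \<in> ups"
proof -
  have "list_all (\<lambda>r.
      list_ex (\<lambda>j. (j + r) mod 13 < 12 \<and> j \<in> ups \<and> (j + r) mod 13 \<notin> ups) [0..<12] \<and>
      list_ex (\<lambda>j. (j + r) mod 13 < 12 \<and> j \<notin> ups \<and> (j + r) mod 13 \<in> ups) [0..<12]) [1..<13]"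
    by code_simp
  moreover have "r \<in> set [1..<13]"
    using assms by (simp del: upt_rec_numeral)
  ultimately have *:
    "list_ex (\<lambda>j. (j + r) mod 13 < 12 \<and> j \<in> ups \<and> (j + r) mod 13 \<notin> ups) [0..<12] \<and>
     list_ex (\<lambda>j. (j + r) mod 13 < 12 \<and> j \<notin> ups \<and> (j + r) mod 13 \<in> ups) [0..<12]"
    unfolding list_all_iff by blast
  show "\<exists>j<12. (j + r) mod 13 < 12 \<and> j \<in> ups \<and> (j + r) mod 13 \<notin> ups"
    and "\<exists>j<12. (j + r) mod 13 < 12 \<and> j \<notin> ups \<and> (j + r) mod 13 \<in> ups"
    using * unfolding list_ex_iff set_upt by auto
qed

lemma up_shift:
  assumes "\<not> 13 dvd p"
  obtains j j' where "j < 13" "\<And>i. up (13 * i + j) \<and> \<not> up (13 * i + j + p)"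
    "j' < 13" "\<And>i. \<not> up (13 * i + j') \<and> up (13 * i + j' + p)"
proof -
  have *: "up (13 * i + j + p) \<longleftrightarrow> (j + p mod 13) mod 13 \<in> ups"
    if "(j + p mod 13) mod 13 < 12" for i j
  proof -
    have "13 * i + j + p = 13 * (i + (j + p) div 13) + (j + p mod 13) mod 13"
      by (simp add: mod_add_right_eq algebra_simps)
    then show ?thesis
      using up_inner[OF that] by metis
  qed
  have r: "0 < p mod 13" "p mod 13 < 13"
    using assms by (auto simp: dvd_eq_mod_eq_0)
  obtain j where j: "j < 12" "(j + p mod 13) mod 13 < 12" "j \<in> ups" "(j + p mod 13) mod 13 \<notin> ups"
    using ups_shift(1)[OF r] by blast
  obtain j' where j': "j' < 12" "(j' + p mod 13) mod 13 < 12" "j' \<notin> ups" "(j' + p mod 13) mod 13 \<in> ups"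
    using ups_shift(2)[OF r] by blast
  show ?thesis
  proof
    show "j < 13" "j' < 13"
      using j(1) j'(1) by linarith+
    show "up (13 * i + j) \<and> \<not> up (13 * i + j + p)" for i
      using *[OF j(2)] up_inner[OF j(1)] j by blast
    show "\<not> up (13 * i + j') \<and> up (13 * i + j' + p)" for i
      using *[OF j'(2)] up_inner[OF j'(1)] j' by blast
  qed
qed

section \<open>Short squares excluded by finite evaluation\<close>

definition three_blocks :: "nat \<Rightarrow> nat \<Rightarrow> nat \<Rightarrow> nat list" where
  "three_blocks x y z = concat (map (\<lambda>u. map (\<lambda>t. (u + t) mod 3) leech_block) [x, y, z])"

definition no_short_square :: "nat list \<Rightarrow> bool" where
  "no_short_square w \<longleftrightarrow>
     list_all (\<lambda>b. list_all (\<lambda>p. take p (drop b w) \<noteq> take p (drop (b + p) w)) [1..<13]) [0..<13]"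

lemma three_blocks_no_short_square:
  assumes "x < 3" "y < 3" "z < 3" "x \<noteq> y" "y \<noteq> z"
  shows "no_short_square (three_blocks x y z)"
proof -
  have "list_all (\<lambda>(x, y, z). no_short_square (three_blocks x y z))
    (filter (\<lambda>(x, y, z). x \<noteq> y \<and> y \<noteq> z) (List.product [0..<3] (List.product [0..<3] [0..<3])))"
    by code_simp
  then show ?thesis
    using assms by (auto simp: list_all_iff)
qed

lemma length_three_blocks: "length (three_blocks x y z) = 39"
  by (simp add: three_blocks_def length_leech_block)

lemma leech_eq_three_blocks:
  assumes "t < 39"
  shows "leech (13 * i + t) = three_blocks (leech i) (leech (i + 1)) (leech (i + 2)) ! t"
proof -
  consider "t < 13" | "13 \<le> t" "t < 26" | "26 \<le> t"
    by linarith
  then show ?thesis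
  proof cases
    case 1
    then show ?thesis
      by (subst leech_block_eq) (auto simp: three_blocks_def nth_append length_leech_block)
  next
    case 2
    then have "13 * i + t = 13 * (i + 1) + (t - 13)" "t - 13 < 13"
      by auto
    with 2 show ?thesis
      by (simp only: leech_block_eq) (auto simp: three_blocks_def nth_append length_leech_block)
  next
    case 3
    then have "13 * i + t = 13 * (i + 2) + (t - 26)" "t - 26 < 13"
      using assms by auto
    with 3 show ?thesis
      by (simp only: leech_block_eq) (auto simp: three_blocks_def nth_append length_leech_block)
  qed
qed

text \<open>Starting at an offset of at most 12 with period at most 12, a square ends within the
  first 36 letters counted from its block's start. Three blocks suffice, and their coding letters
  are three letters with adjacent ones distinct: 12 cases to evaluate.\<close>

lemma leech_no_short_square:
  assumes "0 < p" "p < 13"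
  shows "\<not> square_at leech k p"
proof
  assume sq: "square_at leech k p"
  define i b where "i = k div 13" and "b = k mod 13"
  have k: "k = 13 * i + b" "b < 13"
    by (auto simp: i_def b_def)
  define w where "w = three_blocks (leech i) (leech (i + 1)) (leech (i + 2))"
  have w: "length w = 39" "\<And>t. t < 39 \<Longrightarrow> w ! t = leech (13 * i + t)"
    using length_three_blocks leech_eq_three_blocks by (simp_all only: w_def)
  have "no_short_square w"
    unfolding w_def using leech_step_neq[of i] leech_step_neq[of "i + 1"]
    by (intro three_blocks_no_short_square leech_less_3) simp_all
  then have "take p (drop b w) \<noteq> take p (drop (b + p) w)"
    using k(2) assms by (simp add: no_short_square_def list_all_iff del: upt_rec_numeral)
  moreover have "take p (drop b w) = take p (drop (b + p) w)"
  proof (rule nth_equalityI)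
    fix j
    assume "j < length (take p (drop b w))"
    then have j: "j < p"
      by simp
    then have "leech (k + j) = leech (k + p + j)"
      using sq by (simp add: square_at_def)
    then show "take p (drop b w) ! j = take p (drop (b + p) w) ! j"
      using j k assms w by (simp add: add.assoc)
  qed (use k(2) assms w(1) in simp)
  ultimately show False
    by blast
qed

section \<open>Squarefreeness by descent on the period\<close>

lemma residue_in_window:
  fixes k j m :: nat
  assumes "j < m"
  obtains i where "k \<le> m * i + j" "m * i + j < k + m"
proof
  \<comment> \<open>This is the ceiling of \<open>(k - j) / m\<close>, written without negative
    numbers.\<close>
  let ?i = "(k + (m - 1 - j)) div m"
  have "m * ?i + (k + (m - 1 - j)) mod m = k + (m - 1 - j)"
    by simp
  moreover have "(k + (m - 1 - j)) mod m < m"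
    using assms by simp
  ultimately show "k \<le> m * ?i + j" "m * ?i + j < k + m"
    using assms by linarith+
qed

lemma leech_squarefree: "\<not> square_at leech k p"
proof (induction p arbitrary: k rule: less_induct)
  case (less p)
  show ?case
  proof
    assume sq: "square_at leech k p"
    then have p: "p > 0"
      by (simp add: square_at_def)
    have eq: "leech n = leech (n + p)" if "k \<le> n" "n < k + p" for n
      using sq[unfolded square_at_def, THEN conjunct2, rule_format, of "n - k"] that
      by (simp add: algebra_simps)
    show False
    proof (cases "13 dvd p")
      case True
      then obtain q where q: "p = 13 * q" ..
      \<comment> \<open>The first multiple of 13 from \<open>k\<close> on is \<open>13 * c\<close>.
        Sampling the square at multiples of 13 gives a square of period \<open>q\<close> in the same
        word; the last sample is at most \<open>k + 12 + 13 * (q - 1)\<close>, hence below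
        \<open>k + p\<close>.\<close>
      define c where "c = (k + 12) div 13"
      have c: "k \<le> 13 * c" "13 * c \<le> k + 12"
        unfolding c_def by linarith+
      have "leech (c + j) = leech (c + q + j)" if "j < q" for j
      proof -
        have "leech (13 * (c + j)) = leech (13 * (c + j) + p)"
          by (rule eq; use c that q in simp)
        also have "13 * (c + j) + p = 13 * (c + q + j)"
          by (simp add: q)
        finally show ?thesis
          by (simp only: leech_mult_13)
      qed
      then have "square_at leech c q"
        using p q by (simp add: square_at_def)
      with less.IH[of q c] p q show False
        by simp
    next
      case False
      \<comment> \<open>A window of 13 positions contains the offset \<open>j\<close>, and one more
        position is needed to read the step there: 14 in total. The period would preserve that step,
        while \<open>j\<close> was chosen so that shifting by \<open>p\<close> reverses it.\<close>
      have "p \<ge> 14"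
        using False p leech_no_short_square[of p k] sq by (cases "p = 13") (simp, linarith)
      obtain j where j: "j < 13" "\<And>i. up (13 * i + j) \<and> \<not> up (13 * i + j + p)"
        using up_shift[OF False] by metis
      obtain i where i: "k \<le> 13 * i + j" "13 * i + j < k + 13"
        using residue_in_window[OF j(1)] .
      have "leech (13 * i + j) = leech (13 * i + j + p)"
        "leech (Suc (13 * i + j)) = leech (Suc (13 * i + j + p))"
        using eq[of "13 * i + j"] eq[of "Suc (13 * i + j)"] i \<open>p \<ge> 14\<close> by auto
      then show False
        using j(2)[of i] by (simp add: up_def)
    qed
  qed
qed

section \<open>Distances between palindromes\<close>

text \<open>The bound 2 leaves room for one letter before the palindrome, where the delicate word
  will start.\<close>

definition centre :: "nat \<Rightarrow> bool" where
  "centre c \<longleftrightarrow> c \<ge> 2 \<and> leech (c - 1) = leech (c + 1)"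

lemma centre_inner:
  assumes "j \<in> {2, 6, 10}"
  shows "centre (13 * i + j)"
proof -
  have "13 * i + j - 1 = 13 * i + (j - 1)" "13 * i + j + 1 = 13 * i + (j + 1)"
    using assms by auto
  moreover have "leech (13 * i + (j - 1)) = leech (13 * i + (j + 1))"
    using assms by (subst (1 2) leech_block_eq) (auto simp: leech_block_def)
  ultimately show ?thesis
    using assms by (auto simp: centre_def)
qed

text \<open>The block ends with 1, 0 relative to its coding letter, and an up step makes the next
  block start with that same 1.\<close>

lemma centre_up:
  assumes "up i"
  shows "centre (13 * i + 12)"
proof -
  have "13 * i + 12 - 1 = 13 * i + 11" "13 * i + 12 + 1 = Suc (13 * i + 12)"
    by simp_all
  moreover have "leech (13 * i + 11) = leech (Suc i)"
    using assms by (subst leech_block_eq) (auto simp: leech_block_def up_def)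
  ultimately show ?thesis
    using leech_boundary(2)[of i] by (simp only: centre_def) simp
qed

text \<open>The next block starts with its coding letter and then that letter plus 1; after a down
  step the latter is the coding letter that ended the current block.\<close>

lemma centre_not_up:
  assumes "\<not> up i"
  shows "centre (13 * i + 13)"
proof -
  have "leech (Suc i) = (leech i + 2) mod 3"
    using assms by (simp add: not_up_iff)
  then have "leech i = (leech (Suc i) + 1) mod 3"
    using leech_less_3[of i] by (auto simp: mod_if)
  also have "\<dots> = leech (13 * Suc i + 1)"
    by (subst leech_block_eq) (auto simp: leech_block_def)
  also have "13 * Suc i + 1 = 13 * i + 13 + 1"
    by simp
  finally have "leech (13 * i + 12) = leech (13 * i + 13 + 1)"
    by (simp only: leech_boundary)
  moreover have "13 * i + 13 - 1 = 13 * i + 12"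
    by simp
  ultimately show ?thesis
    by (simp only: centre_def) simp
qed

lemma up_not_up_distance:
  assumes "q > 0"
  shows "(\<exists>i. up i \<and> \<not> up (i + q)) \<and> (\<exists>i. \<not> up i \<and> up (i + q))"
  using assms
proof (induction q rule: less_induct)
  case (less q)
  show ?case
  proof (cases "13 dvd q")
    case True
    then obtain m where m: "q = 13 * m" ..
    \<comment> \<open>Offsets 12 reproduce the steps of the coding word, so a distance
      \<open>13 * m\<close> reduces to \<open>m\<close>.\<close>
    have "up (13 * i + 12 + q) \<longleftrightarrow> up (i + m)" for i
      using up_boundary[of "i + m"] by (simp add: m algebra_simps)
    moreover have "(\<exists>i. up i \<and> \<not> up (i + m)) \<and> (\<exists>i. \<not> up i \<and> up (i + m))"
      using less m by simp
    ultimately show ?thesis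
      using up_boundary by metis
  next
    case False
    then show ?thesis
      using up_shift by metis
  qed
qed

text \<open>Split by the residue of \<open>d\<close> modulo 13. Two inner centres give 0, 4, 5, 8,
  9; an inner and a boundary centre give 2, 3, 6, 7, 10, 11; two boundary centres give 1 and 12.
  Distance 1 itself would force a square of period 2.\<close>

lemma centres_at_distance:
  assumes "d \<noteq> 1"
  shows "\<exists>c. centre c \<and> centre (c + d)"
proof -
  define q r where "q = d div 13" and "r = d mod 13"
  have d: "d = 13 * q + r" "r < 13"
    by (auto simp: q_def r_def)
  have inner: ?thesis
    if "x \<in> {2, 6, 10}" "y \<in> {2, 6, 10}" "d + x = 13 * m + y" for x y m
  proof -
    have "centre x" "centre (13 * m + y)"
      using centre_inner[OF that(1), of 0] centre_inner[OF that(2)] by simp_all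
    then show ?thesis
      using that(3) by (metis add.commute)
  qed
  \<comment> \<open>The boundary centre is taken at block \<open>13 * q + j\<close>, whose step
    depends only on \<open>j\<close>; the inner centre lies \<open>q\<close> blocks earlier. Below,
    \<open>j = 0\<close> supplies an up step and \<open>j = 2\<close> a down step.\<close>
  have outer: ?thesis
    if "x \<in> {2, 6, 10}" "y = 12 \<and> j \<in> ups \<or> y = 13 \<and> j \<notin> ups" "j < 12" "d + x = 13 * q + y"
    for x y j
  proof -
    have "centre (13 * (12 * q + j) + x)"
      by (rule centre_inner[OF that(1)])
    moreover have "centre (13 * (13 * q + j) + y)"
      using that centre_up[of "13 * q + j"] centre_not_up[of "13 * q + j"] up_inner[of j q] by auto
    moreover have "13 * (13 * q + j) + y = 13 * (12 * q + j) + x + d"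
      using that(4) by simp
    ultimately show ?thesis
      by metis
  qed
  have ups: "0 \<in> ups" "2 \<notin> ups"
    by (auto simp: ups_def)
  have "r \<in> set [0..<13]"
    using d(2) by simp
  then consider "r = 0" | "r = 1" | "r = 2" | "r = 3" | "r = 4" | "r = 5" | "r = 6" | "r = 7"
    | "r = 8" | "r = 9" | "r = 10" | "r = 11" | "r = 12"
    by (auto simp: upt_rec simp del: set_upt)
  then show ?thesis
  proof cases
    case 2
    \<comment> \<open>The centre before one boundary and the centre after a boundary
      \<open>q\<close> blocks later are \<open>13 * q + 1\<close> apart. For \<open>q = 0\<close>
      the same boundary would have to be both up and down.\<close>
    then have "q > 0"
      using assms d by (cases q) auto
    then obtain i where "up i" "\<not> up (i + q)"
      using up_not_up_distance by blast
    then have "centre (13 * i + 12)" "centre (13 * (i + q) + 13)"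
      using centre_up centre_not_up by blast+
    moreover have "13 * (i + q) + 13 = 13 * i + 12 + d"
      using d 2 by simp
    ultimately show ?thesis
      by metis
  next
    case 13
    \<comment> \<open>The roles are reversed, and \<open>Suc q\<close> appears because
      \<open>13 * q + 12 = 13 * (q + 1) - 1\<close>.\<close>
    obtain i where "\<not> up i" "up (i + Suc q)"
      using up_not_up_distance[of "Suc q"] by blast
    then have "centre (13 * i + 13)" "centre (13 * (i + Suc q) + 12)"
      using centre_up centre_not_up by blast+
    moreover have "13 * (i + Suc q) + 12 = 13 * i + 13 + d"
      using d 13 by simp
    ultimately show ?thesis
      by metis
  next
    case 1 then show ?thesis using inner[of 2 2 q] d by simp
  next
    case 3 then show ?thesis using outer[of 10 12 0] ups d by simp
  next
    case 4 then show ?thesis using outer[of 10 13 2] ups d by simp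
  next
    case 5 then show ?thesis using inner[of 2 6 q] d by simp
  next
    case 6 then show ?thesis using inner[of 10 2 "Suc q"] d by simp
  next
    case 7 then show ?thesis using outer[of 6 12 0] ups d by simp
  next
    case 8 then show ?thesis using outer[of 6 13 2] ups d by simp
  next
    case 9 then show ?thesis using inner[of 2 10 q] d by simp
  next
    case 10 then show ?thesis using inner[of 6 2 "Suc q"] d by simp
  next
    case 11 then show ?thesis using outer[of 2 12 0] ups d by simp
  next
    case 12 then show ?thesis using outer[of 2 13 2] ups d by simp
  qed
qed

section \<open>Delicate words as factors of the Leech word\<close>

lemma delicate_exists:
  assumes "n \<ge> 5" "n \<noteq> 6"
  shows "\<exists>w. delicate w \<and> length w = n"
proof -
  \<comment> \<open>In a word of length \<open>n\<close> the two palindromes are centred at indices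
    2 and \<open>n - 3\<close>, which are \<open>n - 5\<close> apart; they coincide for
    \<open>n = 5\<close>.\<close>
  have "n - 5 \<noteq> 1"
    using assms by linarith
  then obtain c where "centre c" "centre (c + (n - 5))"
    using centres_at_distance by blast
  obtain s where s: "leech (s + 1) = leech (s + 3)"
    "leech (s + (n - 4)) = leech (s + (n - 2))"
  proof (rule that[of "c - 2"])
    have "c - 2 + 1 = c - 1" "c - 2 + 3 = c + 1"
      "c - 2 + (n - 4) = c + (n - 5) - 1" "c - 2 + (n - 2) = c + (n - 5) + 1"
      using \<open>centre c\<close> assms(1) by (auto simp: centre_def)
    then show "leech (c - 2 + 1) = leech (c - 2 + 3)" "leech (c - 2 + (n - 4)) = leech (c - 2 + (n - 2))"
      using \<open>centre c\<close> \<open>centre (c + (n - 5))\<close> by (simp_all only: centre_def)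
  qed
  define w where "w = map leech [s..<s + n]"
  have len: "length w = n" and nth: "\<And>i. i < n \<Longrightarrow> w ! i = leech (s + i)"
    by (auto simp: w_def)
  have "leech k \<in> alphabet" for k
    using leech_less_3[of k] by (auto simp: alphabet_def)
  then have "w \<in> lists alphabet"
    by (auto simp: w_def)
  moreover have "squarefree_word w"
    unfolding squarefree_word_iff
  proof (intro allI impI notI)
    fix k p
    assume "k + 2 * p \<le> length w" "square_at (nth w) k p"
    then have "square_at leech (s + k) p"
      by (auto simp: square_at_def len nth add.assoc)
    then show False
      using leech_squarefree by blast
  qed
  ultimately have "delicate w"
    by (rule delicateI) (use assms len nth s in auto)
  with len show ?thesis
    by blast
qed

section \<open>Short words\<close>

text \<open>An executable test: both the period and the start range over finite lists.\<close>

definition has_square :: "nat list \<Rightarrow> bool" where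
  "has_square w \<longleftrightarrow>
     list_ex (\<lambda>p. list_ex (\<lambda>k. list_all (\<lambda>j. w ! (k + j) = w ! (k + p + j)) [0..<p])
       [0..<Suc (length w - 2 * p)]) [1..<Suc (length w div 2)]"

lemma has_square: "(\<exists>u. sublist u w \<and> square u) \<longleftrightarrow> has_square w"
proof -
  have "k + 2 * p \<le> length w \<and> p > 0 \<longleftrightarrow>
      p \<in> {1..<Suc (length w div 2)} \<and> k \<in> {0..<Suc (length w - 2 * p)}" for k p
    by auto
  then show ?thesis
    unfolding has_square_iff has_square_def square_at_def list_ex_iff list_all_iff set_upt
    by (metis atLeastLessThan_iff le0)
qed

definition is_delicate :: "nat list \<Rightarrow> bool" where
  "is_delicate w \<longleftrightarrow>
     list_all (\<lambda>i. list_all (\<lambda>a. a = w ! i \<or> has_square (w[i := a])) [0, 1, 2]) [0..<length w]"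

lemma no_short_delicate:
  assumes "delicate w"
  shows "length w \<notin> {0, 1, 2, 3, 4, 6}"
proof
  assume len: "length w \<in> {0, 1, 2, 3, 4, 6}"
  have w: "w \<in> lists (set [0, 1, 2])" and ne: "w \<noteq> []" and sf: "\<not> has_square w"
    using assms has_square unfolding delicate_def squarefree_word_def alphabet_def by auto
  have "is_delicate w"
    using assms unfolding is_delicate_def delicate_def alphabet_def has_square list_all_iff by auto
  \<comment> \<open>Exhaustive search over the squarefree words of these lengths. Length 0 is left
    to \<open>ne\<close>, since the empty word passes \<open>is_delicate\<close> vacuously.\<close>
  moreover have "list_all (\<lambda>w. \<not> is_delicate w)
    (filter (\<lambda>w. \<not> has_square w) (concat (map (\<lambda>n. List.n_lists n [0, 1, 2]) [1, 2, 3, 4, 6])))"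
    by code_simp
  moreover have "w \<in> set (List.n_lists (length w) [0, 1, 2])"
    using w by (auto simp: set_n_lists)
  ultimately show False
    using len ne sf unfolding list_all_iff by auto
qed

theorem theorem3:
  fixes n :: nat
  shows "(\<exists>w. delicate w \<and> length w = n) \<longleftrightarrow> n \<in> {5} \<union> {m. m \<ge> 7}"
proof
  assume "\<exists>w. delicate w \<and> length w = n"
  then have "n \<notin> {0, 1, 2, 3, 4, 6}"
    using no_short_delicate by blast
  then show "n \<in> {5} \<union> {m. m \<ge> 7}"
    by simp linarith
next
  assume "n \<in> {5} \<union> {m. m \<ge> 7}"
  then show "\<exists>w. delicate w \<and> length w = n"
    by (intro delicate_exists) auto
qed

end
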